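(* Let $L \subseteq \mathbb{N}$ be an infinite porous set. Then there does not exist a function $f:\mathbb{N}\to\mathbb{N}$ such that for all $k \in \mathbb{N}$ and all graphs $G$, either $G$ contains $k$ pairwise vertex-disjoint $L$-cycles, or there is a set $X \subseteq V(G)$ with $|X| \leq f(k)$ such that the set $\{\,|C| : C \text{ is an } L\text{-cycle of } G - X\,\}$ of cycle lengths from $L$ occurring in $G-X$ has at most $f(k)$ elements.
   Context: $\mathbb{N}$ denotes the set of positive integers. Graphs are finite. For $L \subseteq \mathbb{N}$, an $L$-cycle is a cycle whose length (number of edges, denoted $|C|$) lies in $L$. A set $L \subseteq \mathbb{N}$ is porous if for every $n \in \mathbb{N}$, the set $\mathbb{N}\setminus L$ contains $n$ consecutive integers. *)

theory Defs
  imports "Graph_Theory.Graph_Theory" "HOL-Library.FuncSet"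
begin

text \<open>
  A finite simple graph is a \<^locale>\<open>pair_graph\<close>: a loopless symmetric digraph in which the edge
  \<open>uv\<close> is the pair of arcs \<open>(u, v)\<close>, \<open>(v, u)\<close>. In such a digraph \<^const>\<open>pre_digraph.cycle\<close> also admits
  the closed walk \<open>u, v, u\<close>, which runs twice along one edge and is not a cycle of the undirected
  graph. It is the only exception, and the bound \<open>3 \<le> length C\<close> removes it. A cycle is given by its
  list of arcs, for some choice of starting vertex and orientation, so its length is the length of
  the list.
\<close>

definition L_cycle :: "nat set \<Rightarrow> ('a, 'b) pre_digraph \<Rightarrow> 'b awalk \<Rightarrow> bool" where
  "L_cycle L G C \<longleftrightarrow> pre_digraph.cycle G C \<and> 3 \<le> length C \<and> length C \<in> L"

text \<open>In a closed walk every vertex is the tail of some arc.\<close>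

definition cycle_verts :: "('a, 'b) pre_digraph \<Rightarrow> 'b awalk \<Rightarrow> 'a set" where
  "cycle_verts G C = tail G ` set C"

definition has_disjoint_L_cycles :: "nat set \<Rightarrow> ('a, 'b) pre_digraph \<Rightarrow> nat \<Rightarrow> bool" where
  "has_disjoint_L_cycles L G k \<longleftrightarrow>
     (\<exists>C. (\<forall>i<k. L_cycle L G (C i)) \<and>
          (\<forall>i<k. \<forall>j<k. i \<noteq> j \<longrightarrow> cycle_verts G (C i) \<inter> cycle_verts G (C j) = {}))"

definition delete_verts :: "('a, 'b) pre_digraph \<Rightarrow> 'a set \<Rightarrow> ('a, 'b) pre_digraph" where
  "delete_verts G X = G \<restriction> (verts G - X)"

definition L_cycle_lengths :: "nat set \<Rightarrow> ('a, 'b) pre_digraph \<Rightarrow> nat set" where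
  "L_cycle_lengths L G = {length C | C. L_cycle L G C}"

text \<open>Only sets of positive integers are considered, so the gap must lie in \<open>{1..}\<close>.\<close>

definition porous :: "nat set \<Rightarrow> bool" where
  "porous L \<longleftrightarrow> (\<forall>n\<ge>1. \<exists>m. {m..<m + n} \<subseteq> {1..} - L)"

end

theory Submission
  imports Defs
begin

text \<open>
  Two cycles through one jump each in a disk with jumps between antipodal boundary points must meet,
  although no few vertices hit all of them. Already $k = 2$ fails if the edges are subdivided so that
  the $L$-cycles are among these cycles and still have many lengths. The lengths are assigned one
  edge at a time, each exceeding the sum $S$ of its predecessors, grid edges first. A grid edge gets
  a length $w$ with $[w, w + S]$ disjoint from $L$, so no $L$-cycle has its longest edge in the grid. The
  jump $i$ is made to close its standard path (row $i$, then column $i$) to a cycle of length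
  $l_i \<in> L$ with $(l_i, l_i + S]$ disjoint from $L$: a cycle with longest edge $i$ and another jump
  exceeds $l_i$ by at most $S$, hence is no $L$-cycle. A vertex lies on at most two standard cycles,
  so most of the $l_i$ survive its deletion.

  That two $L$-cycles meet is shown modulo 2: only the even degrees of the edge sets are used.
\<close>

section \<open>Gaps of porous sets\<close>

text \<open>Porosity does not say where a gap lies. A gap of length \<open>K + S + 1\<close> keeps
  \<open>S + 1\<close> members after its first \<open>K\<close> are dropped, and these are all at
  least \<open>K\<close>.\<close>

lemma porous_obtain_gap:
  assumes "porous L"
  obtains q where "K \<le> q" "{q..q + S} \<inter> L = {}"
proof -
  obtain m where m: "{m..<m + (K + S + 1)} \<subseteq> {1..} - L"
    using assms unfolding porous_def by (metis le_add2)
  show ?thesis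
  proof (rule that[of "m + K"])
    have "{m + K..m + K + S} \<subseteq> {m..<m + (K + S + 1)}" by auto
    then show "{m + K..m + K + S} \<inter> L = {}" using m by blast
  qed simp
qed

text \<open>Infinitude supplies some \<open>l0 \<ge> K\<close> in \<open>L\<close>, porosity a gap
  starting at some \<open>q \<ge> l0\<close>, and \<open>l\<close> is the largest element of
  \<open>L\<close> up to \<open>q\<close>. A further element within \<open>S\<close> of
  \<open>l\<close> would exceed \<open>q\<close> by maximality and so fall into the gap.\<close>

lemma porous_obtain_element_before_gap:
  assumes "infinite L" "porous L"
  obtains l where "l \<in> L" "K \<le> l" "{l<..l + S} \<inter> L = {}"
proof -
  obtain l0 where l0: "l0 \<in> L" "K \<le> l0"
    using assms(1) by (metis infinite_nat_iff_unbounded_le)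
  obtain q where q: "l0 \<le> q" "{q..q + S} \<inter> L = {}"
    using porous_obtain_gap[OF assms(2)] by metis
  define l where "l = Max {x \<in> L. x \<le> q}"
  have fin: "finite {x \<in> L. x \<le> q}" by simp
  have l: "l \<in> L" "l \<le> q"
    using Max_in[OF fin] l0 q unfolding l_def by blast+
  have max: "x \<le> l" if "x \<in> L" "x \<le> q" for x
    using Max_ge[OF fin] that unfolding l_def by auto
  have "{l<..l + S} \<inter> L = {}"
  proof (rule ccontr)
    assume "{l<..l + S} \<inter> L \<noteq> {}"
    then obtain x where x: "l < x" "x \<le> l + S" "x \<in> L" by auto
    then have "q < x" using max[of x] by (meson not_le)
    then have "x \<in> {q..q + S} \<inter> L" using x l by auto
    then show False using q by simp
  qed
  moreover have "K \<le> l" using max l0 q by force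
  ultimately show ?thesis using that l by blast
qed

text \<open>Indices below \<open>M\<close> will be grid edges, the later ones jumps, and
  \<open>T m\<close> the standard path closed by jump \<open>m\<close>. Since \<open>T m\<close>
  uses only indices below \<open>M \<le> m\<close>, the condition on each weight refers to earlier
  weights only, and recursion applies.\<close>

lemma gap_adapted_weights_exist:
  fixes T :: "nat \<Rightarrow> nat set"
  assumes "infinite L" "porous L" and T: "\<And>m. M \<le> m \<Longrightarrow> T m \<subseteq> {..<M}"
  obtains w :: "nat \<Rightarrow> nat" where
    "\<And>m. sum w {..<m} + 3 \<le> w m"
    "\<And>m. m < M \<Longrightarrow> {w m..w m + sum w {..<m}} \<inter> L = {}"
    "\<And>m. M \<le> m \<Longrightarrow> w m + sum w (T m) \<in> L"
    "\<And>m. M \<le> m \<Longrightarrow> {w m + sum w (T m)<..w m + sum w (T m) + sum w {..<m}} \<inter> L = {}"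
proof -
  define P :: "(nat \<Rightarrow> nat) \<Rightarrow> nat \<Rightarrow> nat \<Rightarrow> bool" where
    "P = (\<lambda>w m x. sum w {..<m} + 3 \<le> x \<and>
      (if m < M then {x..x + sum w {..<m}} \<inter> L = {}
       else x + sum w (T m) \<in> L \<and>
         {x + sum w (T m)<..x + sum w (T m) + sum w {..<m}} \<inter> L = {}))"
  have "\<exists>w. \<forall>m. P w m (w m)"
  proof (rule dependent_wellorder_choice)
    fix x :: nat and f g :: "nat \<Rightarrow> nat" and m
    assume eq: "\<And>y. y < m \<Longrightarrow> f y = g y"
    have 1: "sum f {..<m} = sum g {..<m}" using eq by (intro sum.cong) auto
    have 2: "sum f (T m) = sum g (T m)" if "M \<le> m"
      using eq T[OF that] that by (intro sum.cong) auto
    show "P f m x = P g m x" using 1 2 unfolding P_def by (cases "m < M") simp_all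
  next
    fix m :: nat and f :: "nat \<Rightarrow> nat"
    show "\<exists>x. P f m x"
    proof (cases "m < M")
      case True
      then show ?thesis
        using porous_obtain_gap[OF assms(2), of "sum f {..<m} + 3" "sum f {..<m}"]
        unfolding P_def by metis
    next
      case False
      obtain l where "l \<in> L" "sum f (T m) + (sum f {..<m} + 3) \<le> l"
          "{l<..l + sum f {..<m}} \<inter> L = {}"
        using porous_obtain_element_before_gap[OF assms(1,2)] by metis
      \<comment> \<open>The jump receives what the path leaves of the target length
        \<open>l\<close>. The lower bound on \<open>l\<close> makes the subtraction exact and the
        result large enough.\<close>
      then have "P f m (l - sum f (T m))" using False unfolding P_def by simp
      then show ?thesis ..
    qed
  qed
  then obtain w where w: "\<And>m. P w m (w m)" by blast
  show ?thesis
    by (rule that[of w]; use w in \<open>force simp: P_def split: if_splits\<close>)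
qed

section \<open>Cycles of digraphs\<close>

text \<open>The vertices of a closed walk after the first are the heads of its arcs, and its start
  is the tail of the first arc. So being a cycle can be read off the arc list alone.\<close>

lemma (in pre_digraph) cycle_iff_distinct_heads:
  "cycle p \<longleftrightarrow> p \<noteq> [] \<and> set p \<subseteq> arcs G \<and> tail G (hd p) \<in> verts G \<and>
     cas (tail G (hd p)) p (tail G (hd p)) \<and> distinct (map (head G) p)"
proof -
  have tail_hd: "u = tail G (hd p)" if "cas u p u" "p \<noteq> []" for u
    using that by (simp add: cas_simp)
  have "distinct (tl (awalk_verts u p)) \<longleftrightarrow> distinct (map (head G) p)"
    if "cas u p u" "p \<noteq> []" for u
    using that by (simp add: awalk_verts_conv')
  then show ?thesis
    unfolding cycle_def awalk_def using tail_hd by metis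
qed

lemma (in pre_digraph) cas_nth:
  "cas u p v \<Longrightarrow> Suc i < length p \<Longrightarrow> head G (p ! i) = tail G (p ! Suc i)"
proof (induct p arbitrary: u i)
  case (Cons e p)
  then show ?case by (cases i; cases p) auto
qed simp

lemma (in pre_digraph) cas_last:
  "cas u p v \<Longrightarrow> p \<noteq> [] \<Longrightarrow> head G (last p) = v"
  by (induct p arbitrary: u) (auto split: if_splits)

lemma (in pre_digraph) cas_appendI:
  "cas u p x \<Longrightarrow> cas x q v \<Longrightarrow> cas u (p @ q) v"
  by (induct p arbitrary: u) auto

text \<open>Indices modulo the length treat the closing step from the last arc to the first like
  every other step.\<close>

lemma (in pre_digraph) cycle_head_eq_tail:
  assumes "cycle p"
  shows "head G (p ! (i mod length p)) = tail G (p ! (Suc i mod length p))"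
proof -
  have p: "p \<noteq> []" "cas (tail G (hd p)) p (tail G (hd p))"
    using assms unfolding cycle_iff_distinct_heads by blast+
  show ?thesis
  proof (cases "Suc (i mod length p) = length p")
    case True
    then have "i mod length p = length p - 1" by linarith
    then have "p ! (i mod length p) = last p" using p(1) by (simp add: last_conv_nth)
    moreover have "Suc i mod length p = 0" using True by (simp add: mod_Suc)
    ultimately show ?thesis using cas_last[OF p(2,1)] p(1) by (simp add: hd_conv_nth)
  next
    case False
    moreover have "i mod length p < length p" using p(1) by simp
    ultimately have "Suc (i mod length p) < length p" by linarith
    moreover have "Suc i mod length p = Suc (i mod length p)" using False by (simp add: mod_Suc)
    ultimately show ?thesis using cas_nth[OF p(2)] by simp
  qed
qed

text \<open>Every head is the tail of the next arc. As there are \<open>length p\<close> distinct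
  heads, there are at least as many tails.\<close>

lemma (in pre_digraph) cycle_distinct_tails:
  assumes "cycle p"
  shows "distinct (map (tail G) p)"
proof (rule card_distinct)
  have p: "p \<noteq> []" "distinct (map (head G) p)"
    using assms by (auto simp: cycle_iff_distinct_heads)
  have "head G ` set p \<subseteq> tail G ` set p"
  proof
    fix x assume "x \<in> head G ` set p"
    then obtain i where "i < length p" "x = head G (p ! i)" by (auto simp: in_set_conv_nth)
    then have "x = tail G (p ! (Suc i mod length p))" using cycle_head_eq_tail[OF assms, of i] by simp
    then show "x \<in> tail G ` set p" using p(1) by simp
  qed
  then have "length p \<le> card (tail G ` set p)"
    using p(2) by (metis card_mono distinct_card finite_imageI length_map list.set_map List.finite_set)
  then show "card (set (map (tail G) p)) = length (map (tail G) p)"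
    using card_length[of "map (tail G) p"] by simp
qed

text \<open>Start and orientation are forgotten: \<open>U\<close> is the set of undirected edges, on
  which the later parity arguments work. The bound 3 keeps these edges distinct and gives each
  vertex of the cycle two different neighbours.\<close>

lemma (in pre_digraph) cycle_edges:
  assumes "cycle p" and n: "3 \<le> length p"
  obtains U where "finite U" "card U = length p" "\<Union>U = tail G ` set p"
    "\<And>s. s \<in> U \<Longrightarrow> \<exists>e \<in> arcs G. s = {tail G e, head G e}"
    "\<And>x. card {y. {x, y} \<in> U} = 0 \<or> card {y. {x, y} \<in> U} = 2"
proof -
  let ?n = "length p"
  have n0: "0 < ?n" using n by linarith
  define c where "c = (\<lambda>i. tail G (p ! (i mod ?n)))"
  have ceq: "c i = c j \<longleftrightarrow> i mod ?n = j mod ?n" for i j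
    using nth_eq_iff_index_eq[OF cycle_distinct_tails[OF assms(1)], of "i mod ?n" "j mod ?n"] n0
    unfolding c_def by simp
  have mod_c: "c (i mod ?n) = c i" "c (Suc (i mod ?n)) = c (Suc i)" for i
    unfolding ceq by (simp_all add: mod_Suc_eq)
  have head: "c (Suc i) = head G (p ! (i mod ?n))" for i
    unfolding c_def by (simp add: cycle_head_eq_tail[OF assms(1)])
  have Suc_Suc: "c i \<noteq> c (Suc (Suc i))" for i
  proof
    assume "c i = c (Suc (Suc i))"
    then have "(i + 2) mod ?n = i mod ?n" by (simp add: ceq)
    then have "?n dvd 2" by (simp add: mod_eq_dvd_iff_nat)
    then show False using n by (auto dest: dvd_imp_le)
  qed
  define U where "U = (\<lambda>i. {c i, c (Suc i)}) ` {..<?n}"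
  have mem: "{c i, c (Suc i)} \<in> U" for i
    unfolding U_def using mod_c n0 by (intro image_eqI[of _ _ "i mod ?n"]) auto
  have Suc_cancel: "c i = c j" if "c (Suc i) = c (Suc j)" for i j
    using that by (auto simp: ceq mod_Suc split: if_splits)
  have Suc_cong: "c (Suc i) = c (Suc j)" if "c i = c j" for i j
    using that by (simp add: ceq mod_Suc)
  have c_inj: "i = j" if "c i = c j" "i < ?n" "j < ?n" for i j
    using that by (simp add: ceq)
  show ?thesis
  proof (rule that[of U])
    show "finite U" by (simp add: U_def)
    have "inj_on (\<lambda>i. {c i, c (Suc i)}) {..<?n}"
    proof (rule inj_onI)
      fix i j assume ij: "i \<in> {..<?n}" "j \<in> {..<?n}" "{c i, c (Suc i)} = {c j, c (Suc j)}"
      have "\<not> (c i = c (Suc j) \<and> c (Suc i) = c j)"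
        using Suc_cong Suc_Suc by metis
      then have "c i = c j" using ij(3) by (auto simp: doubleton_eq_iff)
      then show "i = j" using c_inj ij by simp
    qed
    then show "card U = ?n" by (simp add: U_def card_image)
    have "\<Union>U = c ` {..<?n}"
    proof (intro equalityI subsetI)
      fix x assume "x \<in> \<Union>U"
      then obtain i where "x = c i" unfolding U_def by auto
      then show "x \<in> c ` {..<?n}" using mod_c(1)[of i] n0
        by (intro image_eqI[of _ _ "i mod ?n"]) auto
    qed (auto simp: U_def)
    also have "\<dots> = tail G ` set p"
      unfolding c_def by (auto simp: in_set_conv_nth image_iff) force
    finally show "\<Union>U = tail G ` set p" .
    show "\<exists>e \<in> arcs G. s = {tail G e, head G e}" if s: "s \<in> U" for s
    proof -
      obtain i where i: "i < ?n" "s = {c i, c (Suc i)}" using s by (auto simp: U_def)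
      have "p ! i \<in> arcs G" using i(1) assms(1) by (auto simp: cycle_iff_distinct_heads)
      then show ?thesis using i head[of i] by (intro bexI[of _ "p ! i"]) (auto simp: c_def)
    qed
    show "card {y. {x, y} \<in> U} = 0 \<or> card {y. {x, y} \<in> U} = 2" for x
    \<comment> \<open>A vertex of the cycle is written as \<open>c (Suc i)\<close>, so that its
      neighbours are \<open>c i\<close> and \<open>c (Suc (Suc i))\<close> and no predecessor modulo
      the length is needed.\<close>
    proof (cases "\<exists>i<?n. x = c (Suc i)")
      case True
      then obtain i where i: "i < ?n" "x = c (Suc i)" by blast
      have "{y. {x, y} \<in> U} = {c i, c (Suc (Suc i))}"
      proof (intro equalityI subsetI)
        fix y assume "y \<in> {y. {x, y} \<in> U}"
        then obtain j where "{c (Suc i), y} = {c j, c (Suc j)}" using i by (auto simp: U_def)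
        then show "y \<in> {c i, c (Suc (Suc i))}"
          using Suc_cancel[of i j] Suc_cong[of "Suc i" j] by (auto simp: doubleton_eq_iff)
      qed (use i mem[of i] mem[of "Suc i"] in \<open>auto simp: insert_commute\<close>)
      then show ?thesis using Suc_Suc by simp
    next
      case False
      have "x \<notin> s" if s: "s \<in> U" for s
      proof
        assume "x \<in> s"
        then obtain j where j: "x = c j" using s by (auto simp: U_def)
        have "c (Suc ((j + ?n - 1) mod ?n)) = c (j + ?n)"
          using mod_c(2)[of "j + ?n - 1"] n0 by simp
        then have "x = c (Suc ((j + ?n - 1) mod ?n))" by (simp add: j ceq)
        then show False using False n0 mod_less_divisor by blast
      qed
      then have "{y. {x, y} \<in> U} = {}" by blast
      then show ?thesis by (metis card.empty)
    qed
  qed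
qed

text \<open>A cycle uses each arc at most once. The finiteness allows cardinalities of sets of
  lengths to be compared by inclusion.\<close>

lemma (in fin_digraph) finite_L_cycle_lengths: "finite (L_cycle_lengths L G)"
proof (rule finite_subset)
  show "L_cycle_lengths L G \<subseteq> {..card (arcs G)}"
  proof
    fix l assume "l \<in> L_cycle_lengths L G"
    then obtain p where p: "l = length p" "cycle p"
      by (auto simp: L_cycle_lengths_def L_cycle_def)
    then have "distinct p" "set p \<subseteq> arcs G"
      by (auto simp: cycle_iff_distinct_heads simp: distinct_map)
    then show "l \<in> {..card (arcs G)}"
      using p by (metis atMost_iff card_mono distinct_card finite_arcs)
  qed
qed simp

text \<open>The tails of the arcs are all vertices of the closed walk. If they avoid
  \<open>X\<close>, the walk lies in the induced subgraph.\<close>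

lemma (in wf_digraph) L_cycle_delete_verts:
  assumes "L_cycle L G p" "cycle_verts G p \<inter> X = {}"
  shows "L_cycle L (delete_verts G X) p"
proof -
  obtain u where u: "awalk u p u" "distinct (tl (awalk_verts u p))" "p \<noteq> []"
    using assms(1) by (auto simp: L_cycle_def cycle_def)
  then have "cas u p u" by (simp add: awalk_def)
  then have "u = head G (last p)" "u = tail G (hd p)"
    using u(3) cas_last by (auto simp: cas_simp)
  then have "set (awalk_verts u p) = tail G ` set p"
    using u(3) imageI[OF hd_in_set[of p], of "tail G"] by (auto simp: awalk_verts_conv)
  moreover have "set (awalk_verts u p) \<subseteq> verts G" using u(1) by blast
  ultimately have "set (awalk_verts u p) \<subseteq> verts G - X"
    using assms(2) by (auto simp: cycle_verts_def)
  from awalk_induce[OF u(1) this] show ?thesis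
    using u assms(1) unfolding L_cycle_def delete_verts_def pre_digraph.cycle_def
    by (auto simp: awalk_verts_induce)
qed

section \<open>Subdivisions\<close>

text \<open>For a finite loopless edge set this is membership in the cycle space over the field with
  two elements; the direction of arcs is ignored.\<close>

definition even_degrees :: "('v, 'e) pre_digraph \<Rightarrow> 'e set \<Rightarrow> bool" where
  "even_degrees H F \<longleftrightarrow> (\<forall>v. even (card {e \<in> F. tail H e = v \<or> head H e = v}))"

text \<open>Summing the degrees over \<open>S\<close> counts an edge inside \<open>S\<close> twice
  and an edge of the cut once.\<close>

lemma even_card_cut:
  fixes F :: "'e set" and s d :: "'e \<Rightarrow> 'v"
  assumes fin: "finite F" and loopfree: "\<And>e. e \<in> F \<Longrightarrow> s e \<noteq> d e"
    and deg: "\<And>v. even (card {e \<in> F. s e = v \<or> d e = v})"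
  shows "even (card {e \<in> F. (s e \<in> S) \<noteq> (d e \<in> S)})"
proof -
  have cnt: "card {e \<in> F. P e} = (\<Sum>e\<in>F. of_bool (P e))" for P
    using fin by (simp add: Int_def)
  \<comment> \<open>\<open>S\<close> may be infinite; only the ends of edges of \<open>F\<close>
    contribute to the sum.\<close>
  let ?V = "S \<inter> (s ` F \<union> d ` F)"
  let ?c = "\<lambda>e. \<Sum>v\<in>?V. of_bool (s e = v \<or> d e = v) :: nat"
  have "(\<Sum>v\<in>?V. card {e \<in> F. s e = v \<or> d e = v}) = (\<Sum>v\<in>?V. \<Sum>e\<in>F. of_bool (s e = v \<or> d e = v))"
    by (intro sum.cong cnt refl)
  also have "\<dots> = (\<Sum>e\<in>F. ?c e)" by (rule sum.swap)
  finally have ev: "even (\<Sum>e\<in>F. ?c e)" by (metis (no_types, lifting) deg dvd_sum)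
  have finV: "finite ?V" using fin by simp
  have c: "?c e = of_bool (s e \<in> S) + of_bool (d e \<in> S)" if e: "e \<in> F" for e
  proof -
    have "?c e = (\<Sum>v\<in>?V. of_bool (s e = v) + of_bool (d e = v))"
      using loopfree[OF e] by (intro sum.cong) auto
    also have "\<dots> = of_bool (s e \<in> S) + of_bool (d e \<in> S)"
      using e finV by (simp add: sum.distrib sum.delta of_bool_def)
    finally show ?thesis .
  qed
  have "(\<Sum>e\<in>F. ?c e) = (\<Sum>e\<in>F. of_bool (s e \<in> S) + of_bool (d e \<in> S))"
    using c by (intro sum.cong) auto
  also have "\<dots> = (\<Sum>e\<in>F. of_bool ((s e \<in> S) \<noteq> (d e \<in> S)) + 2 * of_bool (s e \<in> S \<and> d e \<in> S))"
    by (intro sum.cong) auto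
  also have "\<dots> = card {e \<in> F. (s e \<in> S) \<noteq> (d e \<in> S)} + 2 * card {e \<in> F. s e \<in> S \<and> d e \<in> S}"
    unfolding cnt by (simp only: sum.distrib sum_distrib_left)
  finally show ?thesis using ev by simp
qed

lemma pcas_append: "pcas u (p @ q) v \<longleftrightarrow> (\<exists>x. pcas u p x \<and> pcas x q v)"
  by (induct p arbitrary: u) auto

section \<open>The subdivided graph\<close>

text \<open>Each arc \<open>e\<close> becomes a path with \<open>w e\<close> edges. Vertices are
  coded as natural numbers, hence the countable types. Weights of at least 3 provide inner points on
  every path, so that parallel arcs cause no multiple edges.\<close>

locale arc_subdivision = fin_digraph H + loopfree_digraph H
  for H :: "('v::countable, 'e::countable) pre_digraph" +
  fixes w :: "'e \<Rightarrow> nat"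
  assumes weight_ge_3: "e \<in> arcs H \<Longrightarrow> 3 \<le> w e"
begin

definition base :: "'v \<Rightarrow> nat" where
  "base v = to_nat (Inl v :: 'v + 'e \<times> nat)"

definition point :: "'e \<Rightarrow> nat \<Rightarrow> nat" where
  "point e t = (if t = 0 then base (tail H e) else if t = w e then base (head H e)
     else to_nat (Inr (e, t) :: 'v + 'e \<times> nat))"

definition segment :: "'e \<Rightarrow> nat \<Rightarrow> nat set" where
  "segment e t = {point e t, point e (Suc t)}"

definition subdivided :: "nat pair_pre_digraph" where
  "subdivided = \<lparr>pverts = (\<Union>e \<in> arcs H. point e ` {..w e}),
     parcs = {(x, y). \<exists>e \<in> arcs H. \<exists>t < w e. {x, y} = segment e t}\<rparr>"

lemma base_eq_iff [simp]: "base u = base v \<longleftrightarrow> u = v"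
  by (simp add: base_def)

lemma point_0 [simp]: "point e 0 = base (tail H e)"
  by (simp add: point_def)

lemma point_weight [simp]: "e \<in> arcs H \<Longrightarrow> point e (w e) = base (head H e)"
  using weight_ge_3[of e] by (simp add: point_def)

lemma point_inner_eq_iff:
  assumes "0 < t" "t < w e"
  shows "point e' t' = point e t \<longleftrightarrow> e' = e \<and> t' = t" "point e t = point e' t' \<longleftrightarrow> e' = e \<and> t' = t"
  using assms by (auto simp: point_def base_def)

lemma point_inner_neq_base:
  assumes "0 < t" "t < w e"
  shows "point e t \<noteq> base v" "base v \<noteq> point e t"
  using assms by (auto simp: point_def base_def)

lemma point_inj_on:
  assumes "e \<in> arcs H"
  shows "inj_on (point e) {..w e}"
  using assms no_loops[of e] by (auto simp: inj_on_def point_def base_def)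

text \<open>Every segment contains an inner point of its path, and an inner point determines the
  arc. On a single arc the points are distinct.\<close>

lemma segment_eq_iff:
  assumes e: "e \<in> arcs H" "t < w e" and e': "e' \<in> arcs H" "t' < w e'"
  shows "segment e t = segment e' t' \<longleftrightarrow> e = e' \<and> t = t'"
proof
  assume eq: "segment e t = segment e' t'"
  obtain s where s: "s = t \<or> s = Suc t" "0 < s" "s < w e"
    using weight_ge_3[OF e(1)] e(2) by (cases t) auto
  then have "point e s \<in> segment e' t'" using eq by (auto simp: segment_def)
  then have "e = e'" using s by (auto simp: segment_def point_inner_eq_iff)
  then have "{t, Suc t} = {t', Suc t'}"
    using eq e e' inj_on_image_eq_iff[OF point_inj_on[OF e(1)], of "{t, Suc t}" "{t', Suc t'}"]
    by (simp add: segment_def)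
  then show "e = e' \<and> t = t'" using \<open>e = e'\<close> by (auto simp: doubleton_eq_iff)
qed simp

lemma segment_not_singleton:
  assumes "e \<in> arcs H" "t < w e"
  shows "segment e t \<noteq> {x}"
proof
  assume "segment e t = {x}"
  moreover have "point e t \<in> segment e t" "point e (Suc t) \<in> segment e t"
    by (simp_all add: segment_def)
  ultimately have "point e t = point e (Suc t)" by simp
  then show False using inj_onD[OF point_inj_on[OF assms(1)], of t "Suc t"] assms(2) by simp
qed

lemma segment_at_inner:
  assumes "e' \<in> arcs H" "t' < w e'" "0 < t" "t < w e" "{point e t, y} = segment e' t'"
  shows "e' = e \<and> (t' = t \<and> y = point e (Suc t) \<or> Suc t' = t \<and> y = point e (t - 1))"
  using assms by (auto simp: segment_def doubleton_eq_iff point_inner_eq_iff)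

lemma pair_graph_subdivided: "pair_graph subdivided"
proof -
  have v: "point e t \<in> pverts subdivided" if "e \<in> arcs H" "t \<le> w e" for e t
    using that unfolding subdivided_def by auto
  have wf: "x \<in> pverts subdivided \<and> y \<in> pverts subdivided" if xy: "(x, y) \<in> parcs subdivided" for x y
  proof -
    obtain e t where et: "e \<in> arcs H" "t < w e" "{x, y} = segment e t"
      using xy by (auto simp: subdivided_def)
    then show ?thesis using v[of e t] v[of e "Suc t"] by (auto simp: segment_def doubleton_eq_iff)
  qed
  have fin: "finite (pverts subdivided)"
    unfolding subdivided_def using finite_arcs by auto
  have "parcs subdivided \<subseteq> pverts subdivided \<times> pverts subdivided"
    using wf by auto
  then have fin': "finite (parcs subdivided)"
    using fin finite_subset by blast
  have sym: "symmetric (with_proj subdivided)"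
    unfolding symmetric_def by (rule symI) (auto simp: subdivided_def insert_commute)
  have noloop: "fst a \<noteq> snd a" if a: "a \<in> parcs subdivided" for a
  proof
    assume eq: "fst a = snd a"
    obtain e t where "e \<in> arcs H" "t < w e" "{fst a, snd a} = segment e t"
      using a by (auto simp: subdivided_def)
    then show False using segment_not_singleton[of e t "snd a"] eq by simp
  qed
  show ?thesis
    by unfold_locales (use wf fin fin' sym noloop in \<open>auto\<close>)
qed

section \<open>From cycles of the subdivision to even arc sets\<close>

text \<open>An inner point has just two neighbours, so a cycle that uses one segment there uses the
  other as well. Hence the cycle consists of whole paths, and \<open>F\<close> collects their
  arcs.\<close>

lemma arc_set_of_cycle:
  assumes C: "pre_digraph.cycle (with_proj subdivided) C" "3 \<le> length C"
  obtains F where "F \<subseteq> arcs H" "F \<noteq> {}" "even_degrees H F" "length C = sum w F"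
    "\<And>e. e \<in> F \<Longrightarrow> base (tail H e) \<in> cycle_verts (with_proj subdivided) C"
    "\<And>e. e \<in> F \<Longrightarrow> base (head H e) \<in> cycle_verts (with_proj subdivided) C"
proof -
  obtain U where U: "finite U" "card U = length C"
    "\<Union>U = cycle_verts (with_proj subdivided) C"
    and sub: "\<And>s. s \<in> U \<Longrightarrow> \<exists>a \<in> parcs subdivided. s = {fst a, snd a}"
    and deg: "\<And>x. card {y. {x, y} \<in> U} = 0 \<or> card {y. {x, y} \<in> U} = 2"
    using pre_digraph.cycle_edges[OF C] unfolding cycle_verts_def with_proj_simps by metis
  have seg: "\<exists>e \<in> arcs H. \<exists>t < w e. s = segment e t" if s: "s \<in> U" for s
    using sub[OF s] by (auto simp: subdivided_def)
  have nbs: "{y. {x, y} \<in> U} = {y. \<exists>e \<in> arcs H. \<exists>t < w e. segment e t \<in> U \<and> {x, y} = segment e t}" for x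
    using seg by fastforce
  have step: "segment e t \<in> U \<longleftrightarrow> segment e (Suc t) \<in> U" if e: "e \<in> arcs H" "Suc t < w e" for e t
  proof -
    let ?x = "point e (Suc t)"
    have ne: "point e t \<noteq> point e (Suc (Suc t))"
      using inj_onD[OF point_inj_on[OF e(1)], of t "Suc (Suc t)"] e by auto
    have N: "{y. {?x, y} \<in> U} =
      (if segment e t \<in> U then {point e t} else {}) \<union>
      (if segment e (Suc t) \<in> U then {point e (Suc (Suc t))} else {})" (is "?L = ?R")
    proof (intro equalityI subsetI)
      fix y assume "y \<in> ?L"
      then obtain e' t' where "e' \<in> arcs H" "t' < w e'" "segment e' t' \<in> U" "{?x, y} = segment e' t'"
        unfolding nbs by auto
      then show "y \<in> ?R"
        using segment_at_inner[of e' t' "Suc t" e y] e by auto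
    qed (auto simp: segment_def insert_commute split: if_splits)
    show ?thesis using deg[of ?x] ne unfolding N by (auto split: if_splits)
  qed
  define F where "F = {e \<in> arcs H. segment e 0 \<in> U}"
  have F_arcs: "F \<subseteq> arcs H" by (auto simp: F_def)
  have all: "t < w e \<Longrightarrow> segment e t \<in> U \<longleftrightarrow> e \<in> F" if "e \<in> arcs H" for e t
    by (induct t) (use that step in \<open>auto simp: F_def\<close>)
  have U_eq: "U = (\<lambda>(e, t). segment e t) ` (SIGMA e:F. {..<w e})"
  proof (intro equalityI subsetI)
    fix s assume s: "s \<in> U"
    then obtain e t where "e \<in> arcs H" "t < w e" "s = segment e t" using seg by blast
    then show "s \<in> (\<lambda>(e, t). segment e t) ` (SIGMA e:F. {..<w e})"
      using all s by force
  next
    fix s assume "s \<in> (\<lambda>(e, t). segment e t) ` (SIGMA e:F. {..<w e})"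
    then show "s \<in> U" using all F_arcs by auto
  qed
  have finF: "finite F" using F_arcs finite_arcs finite_subset by blast
  have "inj_on (\<lambda>(e, t). segment e t) (SIGMA e:F. {..<w e})"
    using F_arcs by (auto simp: inj_on_def segment_eq_iff subset_iff)
  then have "card U = (\<Sum>e\<in>F. w e)"
    unfolding U_eq using finF by (simp add: card_image)
  then have len: "length C = sum w F" using U(2) by simp
  show ?thesis
  proof (rule that[of F])
    show "F \<noteq> {}" using len C(2) by auto
    show "even_degrees H F"
      unfolding even_degrees_def
    proof
      fix v
      \<comment> \<open>\<open>nb e\<close> is the point next to \<open>base v\<close> on the path
        of \<open>e\<close>. It is an inner point and determines \<open>e\<close>, so it matches the
        arcs of \<open>F\<close> at \<open>v\<close> with the neighbours of \<open>base v\<close> on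
        the cycle.\<close>
      define nb where "nb = (\<lambda>e. if tail H e = v then point e 1 else point e (w e - 1))"
      have inner: "\<exists>t. 0 < t \<and> t < w e \<and> nb e = point e t" if e: "e \<in> F" for e
      proof -
        have "3 \<le> w e" using weight_ge_3 F_arcs e by auto
        then have "0 < (1::nat) \<and> 1 < w e" "0 < w e - 1 \<and> w e - 1 < w e" by linarith+
        then show ?thesis unfolding nb_def by metis
      qed
      have "inj_on nb F"
      proof (rule inj_onI)
        fix e e' assume "e \<in> F" "e' \<in> F" and eq: "nb e = nb e'"
        then obtain t t' where "0 < t" "t < w e" "nb e = point e t" "nb e' = point e' t'"
          using inner by metis
        then show "e = e'" using eq point_inner_eq_iff(1)[of t e e' t'] by metis
      qed
      moreover have "{y. {base v, y} \<in> U} = nb ` {e \<in> F. tail H e = v \<or> head H e = v}"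
      proof (intro equalityI subsetI)
        fix y assume "y \<in> {y. {base v, y} \<in> U}"
        then obtain e t where e: "e \<in> arcs H" "t < w e" "segment e t \<in> U" "{base v, y} = segment e t"
          unfolding nbs by auto
        then have F: "e \<in> F" using all by simp
        consider "base v = point e t" "y = point e (Suc t)" | "base v = point e (Suc t)" "y = point e t"
          using e(4) by (auto simp: segment_def doubleton_eq_iff)
        then show "y \<in> nb ` {e \<in> F. tail H e = v \<or> head H e = v}"
        proof cases
          case 1
          then have "t = 0" using point_inner_neq_base[of t e v] e by (cases t) auto
          then have "tail H e = v" "nb e = y" using 1 by (auto simp: nb_def)
          then show ?thesis using F by blast
        next
          case 2
          then have t: "Suc t = w e" using point_inner_neq_base[of "Suc t" e v] e by (cases "Suc t = w e") auto
          then have "head H e = v" using 2 e(1) by simp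
          \<comment> \<open>\<open>nb\<close> tests the tail first, so the absence of loops is
            needed to reach its second branch.\<close>
          moreover have "nb e = y"
            using t 2 no_loops[OF e(1)] \<open>head H e = v\<close> by (auto simp: nb_def simp flip: t)
          ultimately show ?thesis using F by blast
        qed
      next
        fix y assume "y \<in> nb ` {e \<in> F. tail H e = v \<or> head H e = v}"
        then obtain e where e: "e \<in> F" "tail H e = v \<or> head H e = v" "y = nb e" by auto
        have eH: "e \<in> arcs H" using e F_arcs by auto
        have w: "3 \<le> w e" using weight_ge_3[OF eH] .
        show "y \<in> {y. {base v, y} \<in> U}"
        proof (cases "tail H e = v")
          case True
          then have "{base v, y} = segment e 0" using e by (simp add: nb_def segment_def)
          then show ?thesis using all[OF eH, of 0] e w by simp
        next
          case False
          then have "{base v, y} = segment e (w e - 1)"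
            using e eH w by (auto simp: nb_def segment_def insert_commute)
          then show ?thesis using all[OF eH, of "w e - 1"] e w by simp
        qed
      qed
      ultimately have "card {y. {base v, y} \<in> U} = card {e \<in> F. tail H e = v \<or> head H e = v}"
        by (metis (no_types, lifting) card_image inj_on_subset mem_Collect_eq subsetI)
      then show "even (card {e \<in> F. tail H e = v \<or> head H e = v})"
        using deg[of "base v"] by auto
    qed
    fix e assume e: "e \<in> F"
    then have eH: "e \<in> arcs H" using F_arcs by auto
    have w: "3 \<le> w e" using weight_ge_3[OF eH] .
    have "base (tail H e) \<in> segment e 0" "base (head H e) \<in> segment e (w e - 1)"
      using w eH by (auto simp: segment_def)
    moreover have "segment e 0 \<in> U" "segment e (w e - 1) \<in> U"
      using all[OF eH] e w by auto
    ultimately show "base (tail H e) \<in> cycle_verts (with_proj subdivided) C"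
      "base (head H e) \<in> cycle_verts (with_proj subdivided) C"
      using U(3) by blast+
  qed (use F_arcs len in auto)
qed

section \<open>From cycles of the base graph to the subdivision\<close>

definition arc_path :: "'e \<Rightarrow> (nat \<times> nat) list" where
  "arc_path e = map (\<lambda>t. (point e t, point e (Suc t))) [0..<w e]"

lemma pcas_arc_path:
  assumes "e \<in> arcs H"
  shows "pcas (base (tail H e)) (arc_path e) (base (head H e))"
proof -
  have "pcas (point e 0) (map (\<lambda>t. (point e t, point e (Suc t))) [0..<m]) (point e m)" for m
    by (induct m) (auto simp: pcas_append)
  from this[of "w e"] show ?thesis unfolding arc_path_def using assms by simp
qed

lemma pcas_concat_arc_path:
  "set p \<subseteq> arcs H \<Longrightarrow> cas u p v \<Longrightarrow> pcas (base u) (concat (map arc_path p)) (base v)"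
proof (induct p arbitrary: u)
  case (Cons e p)
  then show ?case using pcas_arc_path[of e] by (auto simp: pcas_append)
qed simp

text \<open>The paths of the arcs are concatenated. No vertex is entered twice: an inner point
  determines its arc and position, and the last points of the paths are the heads of the arcs of
  \<open>p\<close>, which are distinct.\<close>

lemma cycle_of_base_cycle:
  assumes "cycle p"
  obtains C where "pre_digraph.cycle (with_proj subdivided) C" "length C = sum w (set p)"
    "cycle_verts (with_proj subdivided) C \<subseteq> (\<Union>e \<in> set p. point e ` {..w e})"
proof -
  interpret G: pre_digraph "with_proj subdivided" .
  have p: "p \<noteq> []" "set p \<subseteq> arcs H" "cas (tail H (hd p)) p (tail H (hd p))"
    "distinct (map (head H) p)"
    using assms unfolding cycle_iff_distinct_heads by blast+
  then have dist: "distinct p" by (simp add: distinct_map)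
  define C where "C = concat (map arc_path p)"
  have len: "length C = sum w (set p)"
    unfolding C_def using dist
    by (simp add: length_concat arc_path_def comp_def sum_list_distinct_conv_sum_set)
  have w: "3 \<le> w e" if "e \<in> set p" for e using weight_ge_3 that p(2) by auto
  have path_ne: "arc_path e \<noteq> []" if "e \<in> set p" for e
    using w[OF that] by (simp add: arc_path_def)
  have hdC: "C \<noteq> []" "fst (hd C) = base (tail H (hd p))"
  proof -
    obtain e q where eq: "p = e # q" using p(1) by (cases p) auto
    have "C = arc_path e @ concat (map arc_path q)" by (simp add: C_def eq)
    moreover have "hd (arc_path e) = (point e 0, point e (Suc 0))"
      using w[of e] eq by (simp add: arc_path_def hd_map)
    ultimately show "C \<noteq> []" "fst (hd C) = base (tail H (hd p))"
      using path_ne[of e] eq by simp_all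
  qed
  have setC: "set C = (\<Union>e \<in> set p. (\<lambda>t. (point e t, point e (Suc t))) ` {..<w e})"
    unfolding C_def arc_path_def by (auto simp: atLeast0LessThan)
  have arcs: "set C \<subseteq> parcs subdivided"
    unfolding setC subdivided_def using p(2) by (auto simp: segment_def)
  have heads: "distinct (map snd C)"
  proof -
    have "snd ` set C = (\<lambda>(e, t). point e (Suc t)) ` (SIGMA e:set p. {..<w e})"
      unfolding setC by force
    moreover have "inj_on (\<lambda>(e, t). point e (Suc t)) (SIGMA e:set p. {..<w e})"
    proof (rule inj_onI)
      fix x y
      assume x: "x \<in> (SIGMA e:set p. {..<w e})" and y: "y \<in> (SIGMA e:set p. {..<w e})"
        and eq: "(\<lambda>(e, t). point e (Suc t)) x = (\<lambda>(e, t). point e (Suc t)) y"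
      obtain e t e' t' where xy: "x = (e, t)" "y = (e', t')" by (cases x, cases y) blast
      have e: "e \<in> set p" "e' \<in> set p" "t < w e" "t' < w e'" using x y xy by auto
      have eq: "point e (Suc t) = point e' (Suc t')" using eq xy by simp
      consider "Suc t < w e" | "Suc t' < w e'" | "Suc t = w e" "Suc t' = w e'" using e by linarith
      then show "x = y"
      proof cases
        case 1
        then show ?thesis using point_inner_eq_iff(2)[of "Suc t" e e' "Suc t'"] eq xy by simp
      next
        case 2
        then show ?thesis using point_inner_eq_iff(1)[of "Suc t'" e' e "Suc t"] eq xy by simp
      next
        case 3
        have "e \<in> arcs H" "e' \<in> arcs H" using e p(2) by auto
        then have "head H e = head H e'" using eq unfolding 3 by simp
        then have "e = e'" using p(4) e by (auto simp: distinct_map dest: inj_onD)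
        then show ?thesis using 3 xy by simp
      qed
    qed
    ultimately have "card (snd ` set C) = sum w (set p)" by (simp add: card_image)
    then show ?thesis using len by (intro card_distinct) simp
  qed
  have "base (tail H (hd p)) \<in> pverts subdivided"
    using p(1,2) hd_in_set[of p] by (auto simp: subdivided_def intro!: bexI[of _ "hd p"] image_eqI[of _ _ 0])
  then have "G.cycle C"
    unfolding G.cycle_iff_distinct_heads with_proj_simps cas_with_proj_eq hdC(2)
    using hdC(1) arcs heads pcas_concat_arc_path[OF p(2,3)] unfolding C_def by simp
  moreover have "cycle_verts (with_proj subdivided) C \<subseteq> (\<Union>e \<in> set p. point e ` {..w e})"
    unfolding cycle_verts_def with_proj_simps setC by force
  ultimately show ?thesis using that len by blast
qed

end

section \<open>The grid with jumps\<close>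

datatype edge = Hor nat nat | Ver nat nat | Jump nat

instance edge :: countable by countable_datatype

fun edge_tail :: "nat \<Rightarrow> edge \<Rightarrow> nat \<times> nat" where
  "edge_tail n (Hor a b) = (a, b)"
| "edge_tail n (Ver a b) = (a, b)"
| "edge_tail n (Jump i) = (n, i)"

fun edge_head :: "nat \<Rightarrow> edge \<Rightarrow> nat \<times> nat" where
  "edge_head n (Hor a b) = (a, Suc b)"
| "edge_head n (Ver a b) = (Suc a, b)"
| "edge_head n (Jump i) = (i, 0)"

text \<open>The grid is a triangle: row \<open>i\<close> and column \<open>i\<close> meet on the
  diagonal at \<open>(i, i)\<close>, where the standard path turns from one into the other.\<close>

definition grid_edges :: "nat \<Rightarrow> edge set" where
  "grid_edges n = {Hor a b | a b. b < a \<and> a \<le> n} \<union> {Ver a b | a b. b \<le> a \<and> a < n}"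

text \<open>
  The grid vertices $(a, 0)$ down the left side followed by $(n, b)$ along the bottom are in
  boundary order, so the arcs \<open>Jump i\<close> join antipodal points of the boundary of a disk.
\<close>

definition jump_grid :: "nat \<Rightarrow> (nat \<times> nat, edge) pre_digraph" where
  "jump_grid n = \<lparr>verts = {(a, b). b \<le> a \<and> a \<le> n}, arcs = grid_edges n \<union> Jump ` {..n},
     tail = edge_tail n, head = edge_head n\<rparr>"

lemma jump_grid_simps [simp]:
  "verts (jump_grid n) = {(a, b). b \<le> a \<and> a \<le> n}"
  "arcs (jump_grid n) = grid_edges n \<union> Jump ` {..n}"
  "tail (jump_grid n) = edge_tail n"
  "head (jump_grid n) = edge_head n"
  by (simp_all add: jump_grid_def)

lemma finite_grid_edges: "finite (grid_edges n)"
proof (rule finite_subset)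
  show "grid_edges n \<subseteq> case_prod Hor ` ({..n} \<times> {..n}) \<union> case_prod Ver ` ({..n} \<times> {..n})"
    by (fastforce simp: grid_edges_def)
qed simp

text \<open>The ends \<open>(n, i)\<close> and \<open>(i, 0)\<close> of a jump coincide only for
  \<open>i = n = 0\<close>.\<close>

lemma loopfree_jump_grid:
  assumes "0 < n" "e \<in> arcs (jump_grid n)"
  shows "edge_tail n e \<noteq> edge_head n e"
  using assms by (auto simp: grid_edges_def)

section \<open>Cycles through one jump meet\<close>

text \<open>A parity version of the Jordan curve argument. If the edge sets were vertex-disjoint,
  \<open>F\<close> would divide the vertices off it into two sides. No edge of \<open>B\<close>
  changes sides, but \<open>Jump j\<close> does, so an even edge set would meet the cut
  \<open>S\<close> in exactly one edge.\<close>

lemma jump_cycles_meet_ordered: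
  assumes n: "0 < n" and ij: "i < j" "j \<le> n"
    and A: "A \<subseteq> grid_edges n" and B: "B \<subseteq> grid_edges n"
    and evF: "even_degrees (jump_grid n) (insert (Jump i) A)"
    and evF': "even_degrees (jump_grid n) (insert (Jump j) B)"
  shows "\<exists>e \<in> insert (Jump i) A. \<exists>e' \<in> insert (Jump j) B.
    {edge_tail n e, edge_head n e} \<inter> {edge_tail n e', edge_head n e'} \<noteq> {}"
proof (rule ccontr)
  assume neg: "\<not> ?thesis"
  define F where "F = insert (Jump i) A"
  define F' where "F' = insert (Jump j) B"
  have fin: "finite F" "finite F'"
    unfolding F_def F'_def using A B finite_grid_edges[of n] by (auto intro: finite_subset)
  have sub: "F \<subseteq> arcs (jump_grid n)" "F' \<subseteq> arcs (jump_grid n)"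
    unfolding F_def F'_def using A B ij by auto
  note loopfree = loopfree_jump_grid[OF n]
  have cut: "even (card {e \<in> F. (edge_tail n e \<in> S) \<noteq> (edge_head n e \<in> S)})" for S
    using evF fin(1) subsetD[OF sub(1)] loopfree
    unfolding even_degrees_def F_def[symmetric] jump_grid_simps(3,4)
    by (intro even_card_cut) blast+
  have cut': "even (card {e \<in> F'. (edge_tail n e \<in> S) \<noteq> (edge_head n e \<in> S)})" for S
    using evF' fin(2) subsetD[OF sub(2)] loopfree
    unfolding even_degrees_def F'_def[symmetric] jump_grid_simps(3,4)
    by (intro even_card_cut) blast+
  define VF where "VF = edge_tail n ` F \<union> edge_head n ` F"
  have VF: "edge_tail n e \<in> VF" "edge_head n e \<in> VF" if "e \<in> F" for e
    using that unfolding VF_def by auto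
  have VF': "edge_tail n e \<notin> VF" "edge_head n e \<notin> VF" if "e \<in> F'" for e
    using that neg unfolding VF_def F_def F'_def by auto
  have JF: "Jump k \<in> F \<longleftrightarrow> k = i" for k
    using A unfolding F_def grid_edges_def by auto
  have JF': "Jump k \<in> F' \<longleftrightarrow> k = j" for k
    using B unfolding F'_def grid_edges_def by auto
  have VerF: "Ver a b \<in> F \<Longrightarrow> a < n \<and> b \<le> a" for a b
    using A unfolding F_def grid_edges_def by auto
  have iV: "(i, 0) \<in> VF" "(n, i) \<in> VF"
    using VF[of "Jump i"] JF by auto
  \<comment> \<open>The parity of \<open>side v\<close> counts the crossings of \<open>A\<close> with a ray that leaves \<open>v\<close> to the left just
    below its row. The two correction terms account for the ends of \<open>A\<close>, so that the parity changes
    only across \<open>A\<close>; the ends of \<open>Jump j\<close> get different parities.\<close>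
  define left where "left = (\<lambda>a b. card {b'. b' < b \<and> Ver a b' \<in> F})"
  define side :: "nat \<times> nat \<Rightarrow> nat" where
    "side = (\<lambda>(a, b). left a b + of_bool (i \<le> a) + of_bool (a = n \<and> i < b))"
  define S where "S = {v. odd (side v)}"
  \<comment> \<open>Moving right, the ray can gain only \<open>Ver a b\<close>, and the last
    correction term changes only at \<open>(n, i)\<close>. Both would put \<open>(a, b)\<close> on
    \<open>F\<close>.\<close>
  have hor: "side (a, b) = side (a, Suc b)" if "(a, b) \<notin> VF" "(a, Suc b) \<notin> VF" for a b
  proof -
    have "Ver a b \<notin> F" using VF[of "Ver a b"] that by auto
    then have "{b'. b' < b \<and> Ver a b' \<in> F} = {b'. b' < Suc b \<and> Ver a b' \<in> F}"
      using less_Suc_eq by auto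
    then have "left a b = left a (Suc b)" unfolding left_def by simp
    moreover have "\<not> (a = n \<and> i = b)" using iV that by auto
    ultimately show ?thesis unfolding side_def by (auto simp: less_Suc_eq)
  qed
  have ver: "even (side (a, b) + side (Suc a, b))"
    if v: "(a, b) \<notin> VF" "(Suc a, b) \<notin> VF" and "a < n" for a b
  proof -
    \<comment> \<open>\<open>?R\<close> is the part of row \<open>Suc a\<close> to the left of
      column \<open>b\<close>. The edges of \<open>F\<close> leaving it are the vertical ones
      counted by the two rays, and possibly \<open>Jump i\<close>; a horizontal one would end at
      \<open>(Suc a, b)\<close>.\<close>
    let ?R = "{Suc a} \<times> {..<b}"
    let ?J = "if (Suc a = i \<and> 0 < b) \<noteq> (Suc a = n \<and> i < b) then {Jump i} else {}"
    have HorF: "Hor (Suc a) b' \<notin> F" if "Suc b' = b" for b'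
      using VF[of "Hor (Suc a) b'"] v that by auto
    have "{e \<in> F. (edge_tail n e \<in> ?R) \<noteq> (edge_head n e \<in> ?R)}
      = Ver a ` {b'. b' < b \<and> Ver a b' \<in> F} \<union> Ver (Suc a) ` {b'. b' < b \<and> Ver (Suc a) b' \<in> F} \<union> ?J"
      (is "?L = ?RR")
    proof (rule set_eqI)
      fix e show "e \<in> ?L \<longleftrightarrow> e \<in> ?RR"
      proof (cases e)
        case (Hor x y)
        then show ?thesis using HorF[of y] by (auto dest: Suc_lessI)
      next
        case (Ver x y)
        then show ?thesis by (cases "x = a"; cases "x = Suc a"; auto)
      next
        case (Jump k)
        then show ?thesis using JF[of k] by (cases "k = i") auto
      qed
    qed
    moreover have "card ?RR = left a b + left (Suc a) b + card ?J"
    proof (subst card_Un_disjoint)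
      show "card (Ver a ` {b'. b' < b \<and> Ver a b' \<in> F} \<union> Ver (Suc a) ` {b'. b' < b \<and> Ver (Suc a) b' \<in> F}) +
        card ?J = left a b + left (Suc a) b + card ?J"
        unfolding left_def
        by (subst card_Un_disjoint) (auto simp: card_image inj_on_def)
    qed auto
    ultimately have "even (left a b + left (Suc a) b + card ?J)" using cut[of ?R] by simp
    \<comment> \<open>For \<open>b = 0\<close> the set \<open>?R\<close> is empty and misses the end
      \<open>(i, 0)\<close> of the jump, although the term \<open>i \<le> a\<close> changes there.
      That vertex lies on \<open>F\<close>, so the case is excluded.\<close>
    moreover have "b = 0 \<longrightarrow> Suc a \<noteq> i" using iV v by auto
    ultimately show ?thesis unfolding side_def using \<open>a < n\<close>
      by (cases "i \<le> a"; cases "Suc a = i"; cases "b = 0"; cases "Suc a = n"; cases "i < b") auto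
  qed
  have inv: "(edge_tail n e \<in> S) = (edge_head n e \<in> S)" if "e \<in> B" for e
  proof -
    have e: "e \<in> F'" "e \<in> grid_edges n" using that B unfolding F'_def by auto
    note v = VF'[OF e(1)]
    show ?thesis
    proof (cases e)
      case (Hor a b)
      then show ?thesis using v hor[of a b] unfolding S_def by simp
    next
      case (Ver a b)
      then have "a < n" using e unfolding grid_edges_def by auto
      then show ?thesis using Ver v ver[of a b] unfolding S_def by auto
    next
      case (Jump k)
      then show ?thesis using e unfolding grid_edges_def by auto
    qed
  qed
  have left0: "left n b = 0" "left a 0 = 0" for a b
    using VerF unfolding left_def by auto
  \<comment> \<open>No vertical edges are counted at either vertex. As \<open>i < j\<close>, both
    correction terms are 1 at \<open>(n, j)\<close>, but only the first is 1 at
    \<open>(j, 0)\<close>.\<close>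
  have "(n, j) \<notin> S" "(j, 0) \<in> S"
    using ij left0 unfolding S_def side_def by auto
  then have "{e \<in> F'. (edge_tail n e \<in> S) \<noteq> (edge_head n e \<in> S)} = {Jump j}"
    using inv unfolding F'_def by auto
  then show False using cut'[of S] by simp
qed

section \<open>The standard cycles\<close>

text \<open>This is the standard path from \<open>(i, 0)\<close> along row \<open>i\<close> and down
  column \<open>i\<close> to \<open>(n, i)\<close>, from where \<open>Jump i\<close> leads
  back.\<close>

definition arm :: "nat \<Rightarrow> nat \<Rightarrow> edge list" where
  "arm n i = map (Hor i) [0..<i] @ map (\<lambda>a. Ver a i) [i..<n]"

lemma arm_subset_grid_edges: "i \<le> n \<Longrightarrow> set (arm n i) \<subseteq> grid_edges n"
  by (auto simp: arm_def grid_edges_def)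

lemma cycle_arm_Jump:
  assumes "i \<le> n" "0 < n"
  shows "pre_digraph.cycle (jump_grid n) (arm n i @ [Jump i])"
proof -
  interpret pre_digraph "jump_grid n" .
  have row: "cas (i, 0) (map (Hor i) [0..<k]) (i, k)" for k
    by (induct k) (auto intro: cas_appendI simp del: cas_append_iff)
  have col: "cas (i, i) (map (\<lambda>a. Ver a i) [i..<m]) (m, i)" if "i \<le> m" for m
    using that by (induct m rule: nat_induct_at_least)
      (auto intro: cas_appendI simp del: cas_append_iff)
  have "cas (i, 0) (arm n i @ [Jump i]) (i, 0)"
    unfolding arm_def by (intro cas_appendI[OF cas_appendI[OF row col]] assms) simp
  moreover from this have "tail (jump_grid n) (hd (arm n i @ [Jump i])) = (i, 0)"
    using cas_simp[of "arm n i @ [Jump i]"] by blast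
  moreover have "distinct (map (edge_head n) (arm n i @ [Jump i]))"
    unfolding arm_def by (auto simp: distinct_map inj_on_def)
  ultimately show ?thesis
    unfolding cycle_iff_distinct_heads using arm_subset_grid_edges[OF assms(1)] assms by auto
qed

lemma jump_cycles_meet:
  assumes "0 < n" "i \<noteq> j" "i \<le> n" "j \<le> n" "A \<subseteq> grid_edges n" "B \<subseteq> grid_edges n"
    "even_degrees (jump_grid n) (insert (Jump i) A)" "even_degrees (jump_grid n) (insert (Jump j) B)"
  shows "\<exists>e \<in> insert (Jump i) A. \<exists>e' \<in> insert (Jump j) B.
    {edge_tail n e, edge_head n e} \<inter> {edge_tail n e', edge_head n e'} \<noteq> {}"
proof (cases "i < j")
  case True
  then show ?thesis using jump_cycles_meet_ordered[of n i j A B] assms by simp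
next
  case False
  then have "j < i" using assms by simp
  from jump_cycles_meet_ordered[OF assms(1) this assms(3,6,5,8,7)] show ?thesis by (metis Int_commute)
qed

text \<open>An edge determines the only standard cycle that can contain it, so distinct standard
  cycles share no edge.\<close>

fun arm_index :: "edge \<Rightarrow> nat" where
  "arm_index (Hor a b) = a"
| "arm_index (Ver a b) = b"
| "arm_index (Jump i) = i"

lemma arm_index_eq: "e \<in> set (arm n i @ [Jump i]) \<Longrightarrow> arm_index e = i"
  by (auto simp: arm_def)

lemma arm_endpoints:
  assumes "e \<in> set (arm n i @ [Jump i])" "edge_tail n e = (a, b) \<or> edge_head n e = (a, b)"
  shows "i = a \<or> i = b"
  using assms by (auto simp: arm_def)

section \<open>The choice of weights\<close>

text \<open>All jumps come after all grid edges in the order in which the weights are chosen.\<close>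

definition edge_index :: "nat \<Rightarrow> edge \<Rightarrow> nat" where
  "edge_index M e = (case e of Jump i \<Rightarrow> M + i | _ \<Rightarrow> to_nat e)"

lemma edge_index_Jump [simp]: "edge_index M (Jump i) = M + i"
  by (simp add: edge_index_def)

lemma edge_index_grid: "e \<in> grid_edges n \<Longrightarrow> edge_index M e = to_nat e"
  by (auto simp: edge_index_def grid_edges_def)

lemma inj_on_edge_index:
  assumes "\<And>e. e \<in> grid_edges n \<Longrightarrow> to_nat e < M"
  shows "inj_on (edge_index M) (arcs (jump_grid n))"
proof (rule inj_onI)
  fix e e' assume "e \<in> arcs (jump_grid n)" "e' \<in> arcs (jump_grid n)"
    and eq: "edge_index M e = edge_index M e'"
  then consider "e \<in> grid_edges n" "e' \<in> grid_edges n"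
    | i where "e = Jump i" "e' \<in> grid_edges n"
    | i where "e' = Jump i" "e \<in> grid_edges n"
    | i j where "e = Jump i" "e' = Jump j"
    by auto
  then show "e = e'"
  proof cases
    case 1
    then show ?thesis using eq by (simp add: edge_index_grid)
  next
    case 2
    then show ?thesis using eq assms[of e'] by (simp add: edge_index_grid)
  next
    case 3
    then show ?thesis using eq assms[of e] by (simp add: edge_index_grid)
  next
    case 4
    then show ?thesis using eq by simp
  qed
qed

text \<open>For the last property, the edge of largest index in \<open>F\<close> is considered. The
  others together weigh at most the sum of all earlier weights, so the gap chosen for this edge
  decides whether the total can lie in \<open>L\<close>.\<close>

lemma weighted_jump_grid_exists:
  assumes "infinite L" "porous L"
  obtains wt :: "edge \<Rightarrow> nat" where
    "\<And>e. e \<in> arcs (jump_grid n) \<Longrightarrow> 3 \<le> wt e"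
    "\<And>i. i \<le> n \<Longrightarrow> wt (Jump i) + sum wt (set (arm n i)) \<in> L"
    "\<And>i j. i < j \<Longrightarrow> j \<le> n \<Longrightarrow>
      wt (Jump i) + sum wt (set (arm n i)) < wt (Jump j) + sum wt (set (arm n j))"
    "\<And>F. F \<subseteq> arcs (jump_grid n) \<Longrightarrow> F \<noteq> {} \<Longrightarrow> sum wt F \<in> L \<Longrightarrow>
      \<exists>i \<le> n. \<exists>A \<subseteq> grid_edges n. F = insert (Jump i) A"
proof -
  have "finite (to_nat ` grid_edges n)" using finite_grid_edges by simp
  then obtain M where M: "\<And>e. e \<in> grid_edges n \<Longrightarrow> to_nat e < M"
    unfolding finite_nat_set_iff_bounded by auto
  let ?E = "arcs (jump_grid n)"
  let ?ix = "edge_index M"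
  have inj: "inj_on ?ix ?E" by (rule inj_on_edge_index[OF M])
  have armE: "set (arm n i) \<subseteq> ?E" if "i \<le> n" for i
    using arm_subset_grid_edges[OF that] by auto
  have ix_grid: "?ix e < M" if "e \<in> grid_edges n" for e
    using M[OF that] edge_index_grid[OF that] by simp
  \<comment> \<open>Intersecting with the grid keeps \<open>T m\<close> below \<open>M\<close> even
    for \<open>m > M + n\<close>, where no jump corresponds to \<open>m\<close>.\<close>
  define T where "T = (\<lambda>m. ?ix ` (set (arm n (m - M)) \<inter> grid_edges n))"
  have "T m \<subseteq> {..<M}" for m using ix_grid by (auto simp: T_def)
  then obtain W where W: "\<And>m. sum W {..<m} + 3 \<le> W m"
    "\<And>m. m < M \<Longrightarrow> {W m..W m + sum W {..<m}} \<inter> L = {}"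
    "\<And>m. M \<le> m \<Longrightarrow> W m + sum W (T m) \<in> L"
    "\<And>m. M \<le> m \<Longrightarrow> {W m + sum W (T m)<..W m + sum W (T m) + sum W {..<m}} \<inter> L = {}"
    using gap_adapted_weights_exist[OF assms, of M T] by blast
  define wt where "wt = (\<lambda>e. W (?ix e))"
  have reindex: "sum wt F = sum W (?ix ` F)" if "F \<subseteq> ?E" for F
    using sum.reindex[OF inj_on_subset[OF inj that], of W] by (simp add: wt_def comp_def)
  have below: "sum wt F \<le> sum W {..<m}" if "F \<subseteq> ?E" "\<And>e. e \<in> F \<Longrightarrow> ?ix e < m" for F m
    unfolding reindex[OF that(1)] using that(2) by (intro sum_mono2) auto
  have T: "sum W (T (M + i)) = sum wt (set (arm n i))" if "i \<le> n" for i
    using arm_subset_grid_edges[OF that] reindex[OF armE[OF that]] by (simp add: T_def Int_absorb2)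
  define l where "l = (\<lambda>i. wt (Jump i) + sum wt (set (arm n i)))"
  have l: "l i \<in> L" "{l i<..l i + sum W {..<M + i}} \<inter> L = {}" if "i \<le> n" for i
    using W(3,4)[of "M + i"] T[OF that] by (simp_all add: l_def wt_def)
  have finE: "finite ?E" using finite_grid_edges by simp
  show ?thesis
  proof (rule that[of wt])
    show "3 \<le> wt e" for e
      using W(1)[of "?ix e"] unfolding wt_def by linarith
    show "wt (Jump i) + sum wt (set (arm n i)) \<in> L" if "i \<le> n" for i
      using l(1)[OF that] by (simp add: l_def)
    show "wt (Jump i) + sum wt (set (arm n i)) < wt (Jump j) + sum wt (set (arm n j))"
      if ij: "i < j" "j \<le> n" for i j
    proof -
      have "i \<le> n" using ij by simp
      have "Jump i \<notin> set (arm n i)" by (auto simp: arm_def)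
      then have "wt (Jump i) + sum wt (set (arm n i)) = sum wt (insert (Jump i) (set (arm n i)))"
        by simp
      \<comment> \<open>The standard cycle of \<open>i\<close> uses only indices below
        \<open>M + j\<close>, so \<open>Jump j\<close> alone outweighs it.\<close>
      also have "\<dots> \<le> sum W {..<M + j}"
        using ij armE[OF \<open>i \<le> n\<close>] arm_subset_grid_edges[OF \<open>i \<le> n\<close>] ix_grid
        by (intro below) (auto simp: trans_less_add1 subset_iff)
      also have "\<dots> < wt (Jump j)" using W(1)[of "M + j"] by (simp add: wt_def)
      finally show ?thesis by simp
    qed
    fix F assume F: "F \<subseteq> ?E" "F \<noteq> {}" "sum wt F \<in> L"
    have finF: "finite F" using F(1) finE finite_subset by blast
    then have "Max (?ix ` F) \<in> ?ix ` F" using F(2) by (intro Max_in) auto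
    then obtain e where e: "e \<in> F" "?ix e = Max (?ix ` F)" by auto
    have le: "?ix e' \<le> ?ix e" if "e' \<in> F" for e'
      using that finF e(2) by simp
    define F' where "F' = F - {e}"
    have lt: "?ix e' < ?ix e" if "e' \<in> F'" for e'
      using le[of e'] that inj_onD[OF inj, of e' e] e(1) F(1) unfolding F'_def
      by (metis DiffE insertI1 le_neq_implies_less subsetD)
    have F'E: "F' \<subseteq> ?E" using F(1) by (auto simp: F'_def)
    have sum_F: "sum wt F = wt e + sum wt F'"
      unfolding F'_def using finF e(1) by (simp add: sum.remove)
    have sum_F': "sum wt F' \<le> sum W {..<?ix e}" using below[OF F'E lt] .
    have "e \<notin> grid_edges n"
    proof
      assume "e \<in> grid_edges n"
      then have "{wt e..wt e + sum W {..<?ix e}} \<inter> L = {}"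
        using W(2)[OF ix_grid] by (simp add: wt_def)
      moreover have "sum wt F \<in> {wt e..wt e + sum W {..<?ix e}}" using sum_F sum_F' by simp
      ultimately show False using F(3) by blast
    qed
    then obtain i where i: "e = Jump i" "i \<le> n" using e(1) F(1) by auto
    have "F' \<subseteq> grid_edges n"
    proof (rule ccontr)
      assume "\<not> F' \<subseteq> grid_edges n"
      then obtain j where j: "Jump j \<in> F'" using F'E by auto
      \<comment> \<open>Any jump outweighs the whole standard path, which consists of grid edges. A
        second jump therefore lifts the total strictly above \<open>l i\<close>, into the gap that
        follows it.\<close>
      have "sum wt (set (arm n i)) \<le> sum W {..<M + j}"
        using armE[OF i(2)] arm_subset_grid_edges[OF i(2)] ix_grid
        by (intro below) (auto simp: trans_less_add1 subset_iff)
      also have "\<dots> < wt (Jump j)" using W(1)[of "M + j"] by (simp add: wt_def)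
      also have "\<dots> \<le> sum wt F'"
        using finF j by (intro member_le_sum) (auto simp: F'_def)
      finally have "l i < sum wt F" using sum_F i(1) by (simp add: l_def)
      moreover have "sum wt F \<le> l i + sum W {..<M + i}"
        using sum_F sum_F' i(1) by (simp add: l_def)
      ultimately have "sum wt F \<in> {l i<..l i + sum W {..<M + i}}" by simp
      then show False using l(2)[OF i(2)] F(3) by blast
    qed
    moreover have "F = insert (Jump i) F'" using e(1) i(1) by (auto simp: F'_def)
    ultimately show "\<exists>i \<le> n. \<exists>A \<subseteq> grid_edges n. F = insert (Jump i) A" using i(2) by blast
  qed
qed

section \<open>The counterexample graphs\<close>

text \<open>The \<open>n + 1\<close> standard cycles have distinct lengths in \<open>L\<close>, and
  a deleted vertex destroys at most two of them. The bound is stated additively to avoid truncated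
  subtraction.\<close>

lemma pairwise_meeting_robust_graph_exists:
  assumes L: "infinite L" "porous L" and n: "0 < n"
  obtains G :: "nat pair_pre_digraph" where "pair_graph G"
    "\<not> has_disjoint_L_cycles L (with_proj G) 2"
    "\<And>X. finite X \<Longrightarrow> n < card (L_cycle_lengths L (delete_verts (with_proj G) X)) + 2 * card X"
proof -
  obtain wt :: "edge \<Rightarrow> nat" where wt: "\<And>e. e \<in> arcs (jump_grid n) \<Longrightarrow> 3 \<le> wt e"
    and inL: "\<And>i. i \<le> n \<Longrightarrow> wt (Jump i) + sum wt (set (arm n i)) \<in> L"
    and mono: "\<And>i j. i < j \<Longrightarrow> j \<le> n \<Longrightarrow>
      wt (Jump i) + sum wt (set (arm n i)) < wt (Jump j) + sum wt (set (arm n j))"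
    and cls: "\<And>F. F \<subseteq> arcs (jump_grid n) \<Longrightarrow> F \<noteq> {} \<Longrightarrow> sum wt F \<in> L \<Longrightarrow>
      \<exists>i \<le> n. \<exists>A \<subseteq> grid_edges n. F = insert (Jump i) A"
    using weighted_jump_grid_exists[OF L, of n] by blast
  interpret arc_subdivision "jump_grid n" wt
  proof
    show "finite (verts (jump_grid n))"
      by (rule finite_subset[of _ "{..n} \<times> {..n}"]) auto
    show "finite (arcs (jump_grid n))" using finite_grid_edges by simp
    show "tail (jump_grid n) e \<noteq> head (jump_grid n) e" if "e \<in> arcs (jump_grid n)" for e
      using loopfree_jump_grid[OF n that] by simp
    show "tail (jump_grid n) e \<in> verts (jump_grid n)" "head (jump_grid n) e \<in> verts (jump_grid n)"
      if "e \<in> arcs (jump_grid n)" for e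
      using that by (auto simp: grid_edges_def)
  qed (use wt in auto)
  let ?G = "with_proj subdivided"
  interpret G: pair_graph subdivided by (rule pair_graph_subdivided)
  have disjoint: "\<not> has_disjoint_L_cycles L ?G 2"
  proof
    assume "has_disjoint_L_cycles L ?G 2"
    then obtain C where C: "\<forall>i<2::nat. L_cycle L ?G (C i)"
      "\<forall>i<2::nat. \<forall>j<2. i \<noteq> j \<longrightarrow> cycle_verts ?G (C i) \<inter> cycle_verts ?G (C j) = {}"
      unfolding has_disjoint_L_cycles_def by blast
    have disj: "cycle_verts ?G (C 0) \<inter> cycle_verts ?G (C 1) = {}" using C(2) by simp
    have *: "\<exists>i\<le>n. \<exists>A\<subseteq>grid_edges n. even_degrees (jump_grid n) (insert (Jump i) A) \<and>
        (\<forall>e \<in> insert (Jump i) A. base ` {edge_tail n e, edge_head n e} \<subseteq> cycle_verts ?G p)"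
      if p: "L_cycle L ?G p" for p
    proof -
      have "pre_digraph.cycle ?G p" "3 \<le> length p" "length p \<in> L"
        using p by (auto simp: L_cycle_def)
      then obtain F where F: "F \<subseteq> arcs (jump_grid n)" "F \<noteq> {}" "even_degrees (jump_grid n) F"
        "length p = sum wt F"
        "\<And>e. e \<in> F \<Longrightarrow> base (tail (jump_grid n) e) \<in> cycle_verts ?G p"
        "\<And>e. e \<in> F \<Longrightarrow> base (head (jump_grid n) e) \<in> cycle_verts ?G p"
        using arc_set_of_cycle by metis
      then obtain i A where iA: "i \<le> n" "A \<subseteq> grid_edges n" "F = insert (Jump i) A"
        using cls[OF F(1,2)] \<open>length p \<in> L\<close> by auto
      have "\<forall>e \<in> F. base ` {edge_tail n e, edge_head n e} \<subseteq> cycle_verts ?G p"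
        using F(5,6) by simp
      then show ?thesis using F(3) iA by blast
    qed
    have LC: "L_cycle L ?G (C 0)" "L_cycle L ?G (C 1)" using C(1) by simp_all
    obtain i A where i: "i \<le> n" "A \<subseteq> grid_edges n" "even_degrees (jump_grid n) (insert (Jump i) A)"
      "\<And>e. e \<in> insert (Jump i) A \<Longrightarrow> base ` {edge_tail n e, edge_head n e} \<subseteq> cycle_verts ?G (C 0)"
      using *[OF LC(1)] by blast
    obtain j B where j: "j \<le> n" "B \<subseteq> grid_edges n" "even_degrees (jump_grid n) (insert (Jump j) B)"
      "\<And>e. e \<in> insert (Jump j) B \<Longrightarrow> base ` {edge_tail n e, edge_head n e} \<subseteq> cycle_verts ?G (C 1)"
      using *[OF LC(2)] by blast
    have "\<exists>e \<in> insert (Jump i) A. \<exists>e' \<in> insert (Jump j) B.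
        {edge_tail n e, edge_head n e} \<inter> {edge_tail n e', edge_head n e'} \<noteq> {}"
    \<comment> \<open>Two cycles through the same jump meet at its ends.\<close>
    proof (cases "i = j")
      case False
      then show ?thesis using jump_cycles_meet[OF n] i(1-3) j(1-3) by blast
    qed auto
    then obtain e e' v where v: "e \<in> insert (Jump i) A" "e' \<in> insert (Jump j) B"
      "v \<in> {edge_tail n e, edge_head n e}" "v \<in> {edge_tail n e', edge_head n e'}"
      by blast
    have "base v \<in> cycle_verts ?G (C 0)" "base v \<in> cycle_verts ?G (C 1)"
      using i(4)[OF v(1)] j(4)[OF v(2)] v(3,4) by blast+
    then show False using disj by blast
  qed
  define V where "V = (\<lambda>i. \<Union>e \<in> set (arm n i @ [Jump i]). point e ` {..wt e})"
  define l where "l = (\<lambda>i. wt (Jump i) + sum wt (set (arm n i)))"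
  have arcs_loop: "set (arm n i @ [Jump i]) \<subseteq> arcs (jump_grid n)" if "i \<le> n" for i
    using arm_subset_grid_edges[OF that] that by auto
  have ex: "\<exists>p. L_cycle L ?G p \<and> length p = l i \<and> cycle_verts ?G p \<subseteq> V i" if i: "i \<le> n" for i
  proof -
    obtain p where p: "pre_digraph.cycle ?G p" "length p = sum wt (set (arm n i @ [Jump i]))"
      "cycle_verts ?G p \<subseteq> V i"
      using cycle_of_base_cycle[OF cycle_arm_Jump[OF i n]] unfolding V_def by blast
    have "Jump i \<notin> set (arm n i)" by (auto simp: arm_def)
    then have "length p = l i" using p(2) by (simp add: l_def)
    moreover have "3 \<le> l i" using wt[of "Jump i"] i by (simp add: l_def)
    ultimately show ?thesis using p inL[OF i] by (auto simp: L_cycle_def l_def)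
  qed
  \<comment> \<open>A grid vertex \<open>(a, b)\<close> can lie only on the standard cycles of
    \<open>a\<close> and \<open>b\<close>. An inner point lies on a single edge and hence on at most
    one standard cycle.\<close>
  have two: "card {i \<in> {..n}. x \<in> V i} \<le> 2" for x
  proof -
    have "\<exists>a b. \<forall>i\<le>n. x \<in> V i \<longrightarrow> i = a \<or> i = b"
    proof (cases "\<exists>a b. x = base (a, b)")
      case True
      then obtain a b where x: "x = base (a, b)" by blast
      have "i = a \<or> i = b" if i: "i \<le> n" "x \<in> V i" for i
      proof -
        obtain e t where e: "e \<in> set (arm n i @ [Jump i])" "t \<le> wt e" "point e t = base (a, b)"
          using i(2) x unfolding V_def by force
        have eE: "e \<in> arcs (jump_grid n)" using e(1) arcs_loop[OF i(1)] by blast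
        consider "t = 0" | "t = wt e" using point_inner_neq_base(1)[of t e "(a, b)"] e(2,3) by force
        then have "edge_tail n e = (a, b) \<or> edge_head n e = (a, b)"
        proof cases
          case 1
          then show ?thesis using e(3) by simp
        next
          case 2
          then show ?thesis using e(3) point_weight[OF eE] by simp
        qed
        then show ?thesis using arm_endpoints[OF e(1)] by blast
      qed
      then show ?thesis by blast
    next
      case False
      have "\<exists>e t. 0 < t \<and> t < wt e \<and> x = point e t \<and> arm_index e = i" if i: "i \<le> n" "x \<in> V i" for i
      proof -
        obtain e t where e: "e \<in> set (arm n i @ [Jump i])" "t \<le> wt e" "x = point e t"
          using i(2) unfolding V_def by force
        have eE: "e \<in> arcs (jump_grid n)" using e(1) arcs_loop[OF i(1)] by blast
        have "t \<noteq> 0" using False e(3) point_0[of e] by (metis surj_pair)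
        moreover have "t \<noteq> wt e" using False e(3) point_weight[OF eE] by (metis surj_pair)
        ultimately show ?thesis using e arm_index_eq[OF e(1)] by (metis le_neq_implies_less neq0_conv)
      qed
      then have "i = j" if "i \<le> n" "x \<in> V i" "j \<le> n" "x \<in> V j" for i j
        using that point_inner_eq_iff(1) by metis
      then show ?thesis by blast
    qed
    then obtain a b where "{i \<in> {..n}. x \<in> V i} \<subseteq> {a, b}" by blast
    then have "card {i \<in> {..n}. x \<in> V i} \<le> card {a, b}" by (intro card_mono) auto
    also have "\<dots> \<le> 2" by (simp add: card_insert_if)
    finally show ?thesis .
  qed
  have "n < card (L_cycle_lengths L (delete_verts ?G X)) + 2 * card X" if X: "finite X" for X
  proof -
    \<comment> \<open>These are the indices of the standard cycles that \<open>X\<close> may hit;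
      the others survive the deletion.\<close>
    define Bad where "Bad = (\<Union>x \<in> X. {i \<in> {..n}. x \<in> V i})"
    have "card Bad \<le> (\<Sum>x\<in>X. card {i \<in> {..n}. x \<in> V i})"
      unfolding Bad_def using X by (rule card_UN_le)
    also have "\<dots> \<le> 2 * card X" using sum_bounded_above[of X "\<lambda>x. card {i \<in> {..n}. x \<in> V i}" 2] two
      by (simp add: mult.commute)
    finally have Bad: "card Bad \<le> 2 * card X" .
    have "Bad \<subseteq> {..n}" "finite Bad" using X by (auto simp: Bad_def)
    then have good: "card ({..n} - Bad) = Suc n - card Bad" by (simp add: card_Diff_subset)
    have "inj_on l {..n}"
      using mono unfolding l_def
      by (intro linorder_inj_onI) (auto simp: less_imp_neq)
    then have card_l: "card (l ` ({..n} - Bad)) = Suc n - card Bad"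
      using good by (metis Diff_subset card_image inj_on_subset)
    have "l ` ({..n} - Bad) \<subseteq> L_cycle_lengths L (delete_verts ?G X)"
    proof
      fix m assume "m \<in> l ` ({..n} - Bad)"
      then obtain i where i: "i \<le> n" "i \<notin> Bad" "m = l i" by auto
      obtain p where p: "L_cycle L ?G p" "length p = l i" "cycle_verts ?G p \<subseteq> V i"
        using ex[OF i(1)] by blast
      have "V i \<inter> X = {}" using i by (auto simp: Bad_def)
      then have "L_cycle L (delete_verts ?G X) p"
        using p by (intro G.L_cycle_delete_verts) auto
      then show "m \<in> L_cycle_lengths L (delete_verts ?G X)"
        unfolding L_cycle_lengths_def i(3) p(2)[symmetric] by blast
    qed
    moreover have "finite (L_cycle_lengths L (delete_verts ?G X))"
    proof -
      interpret D: wf_digraph "delete_verts ?G X"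
        unfolding delete_verts_def by (rule G.wellformed_induce_subgraph)
      interpret D: fin_digraph "delete_verts ?G X"
        by unfold_locales
          (auto simp: delete_verts_def intro: finite_subset[OF _ G.pair_finite_arcs] G.pair_finite_verts)
      show ?thesis by (rule D.finite_L_cycle_lengths)
    qed
    ultimately have "Suc n - card Bad \<le> card (L_cycle_lengths L (delete_verts ?G X))"
      unfolding card_l[symmetric] by (intro card_mono)
    then show ?thesis using Bad by linarith
  qed
  then show ?thesis using that pair_graph_subdivided disjoint by blast
qed

theorem theorem1p4:
  fixes L :: "nat set"
  assumes "L \<subseteq> {1..}" and "infinite L" and "porous L"
  shows "\<not> (\<exists>f :: nat \<Rightarrow> nat. f \<in> {1..} \<rightarrow> {1..} \<and>
    (\<forall>k\<ge>1. \<forall>G :: nat pair_pre_digraph. pair_graph G \<longrightarrow>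
       has_disjoint_L_cycles L (with_proj G) k \<or>
       (\<exists>X \<subseteq> pverts G. card X \<le> f k \<and>
          card (L_cycle_lengths L (delete_verts (with_proj G) X)) \<le> f k)))"
proof
  assume "\<exists>f :: nat \<Rightarrow> nat. f \<in> {1..} \<rightarrow> {1..} \<and>
    (\<forall>k\<ge>1. \<forall>G :: nat pair_pre_digraph. pair_graph G \<longrightarrow>
       has_disjoint_L_cycles L (with_proj G) k \<or>
       (\<exists>X \<subseteq> pverts G. card X \<le> f k \<and>
          card (L_cycle_lengths L (delete_verts (with_proj G) X)) \<le> f k))"
  then obtain f :: "nat \<Rightarrow> nat" where f: "f \<in> {1..} \<rightarrow> {1..}"
    and EP: "\<And>k G. 1 \<le> k \<Longrightarrow> pair_graph (G :: nat pair_pre_digraph) \<Longrightarrow>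
       has_disjoint_L_cycles L (with_proj G) k \<or>
       (\<exists>X \<subseteq> pverts G. card X \<le> f k \<and>
          card (L_cycle_lengths L (delete_verts (with_proj G) X)) \<le> f k)"
    by blast
  \<comment> \<open>The factor 3 accounts for at most \<open>f 2\<close> remaining lengths and two
    standard cycles lost for each of at most \<open>f 2\<close> deleted vertices.\<close>
  have "0 < 3 * f 2" using f by (auto simp: Pi_iff Suc_le_eq)
  then obtain G :: "nat pair_pre_digraph" where G: "pair_graph G"
    "\<not> has_disjoint_L_cycles L (with_proj G) 2"
    "\<And>X. finite X \<Longrightarrow>
      3 * f 2 < card (L_cycle_lengths L (delete_verts (with_proj G) X)) + 2 * card X"
    using pairwise_meeting_robust_graph_exists[OF assms(2,3), of "3 * f 2"] by metis
  obtain X where X: "X \<subseteq> pverts G" "card X \<le> f 2"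
    "card (L_cycle_lengths L (delete_verts (with_proj G) X)) \<le> f 2"
    using EP[of 2 G] G(1,2) by auto
  interpret pair_graph G by (rule G(1))
  have "finite X" using X(1) pair_finite_verts finite_subset by blast
  from G(3)[OF this] X(2,3) show False by linarith
qed

end
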